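(* Let $D\subset\mathbb{C}$ be a hyperbolic plane domain and let $v:D\rightarrow(-1,1)$ be a real harmonic function. Then for all $z_1,z_2\in D$, $$\mathrm{Hyp}_{\mathbb{D}}(v(z_1),v(z_2))\leq\frac{4}{\pi}\,\mathrm{Hyp}_D(z_1,z_2).$$
   Context: $\mathbb{D}$ is the open unit disk in $\mathbb{C}$, and $(-1,1)\subset\mathbb{D}$ is the real diameter. A plane domain (connected open subset of $\mathbb{C}$) $D$ is hyperbolic if its holomorphic universal covering is $\mathbb{D}$. The hyperbolic density is normalized to have Gaussian curvature $-1$: $\mathrm{Hyp}_{\mathbb{D}}(z)=\frac{2}{1-|z|^2}$ on $\mathbb{D}$, and on a hyperbolic domain $D$ with holomorphic universal covering $\pi:\mathbb{D}\to D$ it is determined by $\mathrm{Hyp}_D(\pi(z))|\pi'(z)|=\mathrm{Hyp}_{\mathbb{D}}(z)$. With two arguments, $\mathrm{Hyp}_D(z_1,z_2)$ denotes the hyperbolic distance, i.e. the infimum of $\int_\gamma \mathrm{Hyp}_D(z)\,|dz|$ over all piecewise smooth paths $\gamma$ in $D$ joining $z_1$ and $z_2$. *)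

theory Defs
  imports "HOL-Analysis.Analysis"
begin

text \<open>Since the disk is simply connected, a holomorphic covering by the disk is automatically
  universal.\<close>

definition universal_covering :: "(complex \<Rightarrow> complex) \<Rightarrow> complex set \<Rightarrow> bool" where
  "universal_covering p D \<longleftrightarrow> p holomorphic_on ball 0 1 \<and> covering_space (ball 0 1) p D"

definition hyperbolic_domain :: "complex set \<Rightarrow> bool" where
  "hyperbolic_domain D \<longleftrightarrow> open D \<and> connected D \<and> (\<exists>p. universal_covering p D)"

text \<open>The density is determined by its pullback under every universal covering; the value is
  independent of the covering and of the preimage because any two universal coverings of a
  hyperbolic domain differ by an automorphism of the disk. On the disk itself the identity is
  a universal covering, so there the density is \<open>2 / (1 - \<bar>z\<bar>\<^sup>2)\<close>. For sets that are not
  hyperbolic domains the value is unspecified.\<close>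

definition hyp_density :: "complex set \<Rightarrow> complex \<Rightarrow> real" where
  "hyp_density D w = (THE r. \<forall>p z. universal_covering p D \<and> z \<in> ball 0 1 \<and> p z = w \<longrightarrow>
      r * cmod (deriv p z) = 2 / (1 - (cmod z)\<^sup>2))"

text \<open>The library predicate \<^const>\<open>valid_path\<close> does not bound the derivative near the
  exceptional points, so it admits paths of infinite length, to which the Henstock-Kurzweil
  integral would assign the length 0. Here the path is \<open>C\<^sup>1\<close> on each closed piece of a
  finite partition.\<close>

definition piecewise_smooth_path :: "(real \<Rightarrow> complex) \<Rightarrow> bool" where
  "piecewise_smooth_path g \<longleftrightarrow> continuous_on {0..1} g \<and>
     (\<exists>S. finite S \<and> {0, 1} \<subseteq> S \<and> S \<subseteq> {0..1} \<and>
        (\<forall>a\<in>S. \<forall>b\<in>S. a < b \<and> {a<..<b} \<inter> S = {} \<longrightarrow>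
          (\<exists>g'. continuous_on {a..b} g' \<and>
             (\<forall>t\<in>{a..b}. (g has_vector_derivative g' t) (at t within {a..b})))))"

definition hyp_length :: "complex set \<Rightarrow> (real \<Rightarrow> complex) \<Rightarrow> real" where
  "hyp_length D g =
     integral {0..1} (\<lambda>t. hyp_density D (g t) * cmod (vector_derivative g (at t within {0..1})))"

definition hyp_dist :: "complex set \<Rightarrow> complex \<Rightarrow> complex \<Rightarrow> real" where
  "hyp_dist D z1 z2 = Inf {hyp_length D g | g.
     piecewise_smooth_path g \<and> path_image g \<subseteq> D \<and> pathstart g = z1 \<and> pathfinish g = z2}"

text \<open>Twice continuously (real) differentiable with vanishing Laplacian: \<open>v'\<close> and \<open>v''\<close> are the
  first and second Frechet derivatives, so \<open>v'' z 1 1\<close> and \<open>v'' z \<i> \<i>\<close> are the pure second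
  partial derivatives with respect to the real and the imaginary part.\<close>

definition real_harmonic_on :: "(complex \<Rightarrow> real) \<Rightarrow> complex set \<Rightarrow> bool" where
  "real_harmonic_on v D \<longleftrightarrow>
     (\<exists>(v' :: complex \<Rightarrow> complex \<Rightarrow>\<^sub>L real) (v'' :: complex \<Rightarrow> complex \<Rightarrow>\<^sub>L complex \<Rightarrow>\<^sub>L real).
        (\<forall>z\<in>D. (v has_derivative blinfun_apply (v' z)) (at z)) \<and>
        (\<forall>z\<in>D. (v' has_derivative blinfun_apply (v'' z)) (at z)) \<and>
        continuous_on D v'' \<and>
        (\<forall>z\<in>D. blinfun_apply (blinfun_apply (v'' z) 1) 1 +
                blinfun_apply (blinfun_apply (v'' z) \<i>) \<i> = 0))"

end

theory Submission
  imports Defs "HOL-Complex_Analysis.Complex_Analysis"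
begin

text \<open>Pull \<open>v\<close> back along a universal covering \<open>p\<close>: on the disk \<open>v \<circ> p\<close> is the real part of a
  holomorphic \<open>F\<close> with values in the strip \<open>\<bar>Re w\<bar> < 1\<close>. The Schwarz-Pick lemma for
  \<open>tan (\<pi> F / 4)\<close>, which maps into the disk, reads
  \<open>(1 - \<bar>z\<bar>\<^sup>2) \<bar>F' z\<bar> \<le> 4/\<pi> cos (\<pi> Re F / 2)\<close>, and \<open>cos (\<pi> x / 2) \<le> 1 - x\<^sup>2\<close> for
  \<open>\<bar>x\<bar> \<le> 1\<close> by concavity of the sine. This is the infinitesimal form of the claim, which is
  then integrated along paths.\<close>

section \<open>Symmetry of the second derivative\<close>

text \<open>The second difference is symmetric in \<open>h\<close> and \<open>k\<close>, so its leading term is, too.\<close>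

lemma second_difference_approx:
  fixes f :: "'a::real_normed_vector \<Rightarrow> real" and f' :: "'a \<Rightarrow> 'a \<Rightarrow>\<^sub>L real"
  assumes S: "open S" "z \<in> S"
    and f': "\<And>x. x \<in> S \<Longrightarrow> (f has_derivative blinfun_apply (f' x)) (at x)"
    and f'': "(f' has_derivative blinfun_apply f'') (at z)"
    and "e > 0"
  shows "eventually (\<lambda>t. \<bar>f (z + t *\<^sub>R h + t *\<^sub>R k) - f (z + t *\<^sub>R h) - f (z + t *\<^sub>R k) + f z - t\<^sup>2 * f'' k h\<bar>
           \<le> e * t\<^sup>2) (at_right 0)"
proof -
  \<comment> \<open>All displacements
    \<open>s *\<^sub>R (t *\<^sub>R h) + c *\<^sub>R (t *\<^sub>R k)\<close> with \<open>s\<close>,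
    \<open>c\<close> in the unit interval have norm at most \<open>t * M\<close>; the summand 1
    keeps \<open>M\<close> positive when \<open>h\<close> and \<open>k\<close> vanish.\<close>
  define M where "M = norm h + norm k + 1"
  have M: "M > 0" "norm h \<le> M" "norm k \<le> M" "norm h + norm k \<le> M"
    by (auto simp: M_def add_nonneg_pos)
  \<comment> \<open>Chosen so that the final error \<open>t * ((2 * e' * t * M) * M)\<close> equals
    \<open>e * t^2\<close>.\<close>
  define e' where "e' = e / (2 * M\<^sup>2)"
  have e': "e' > 0" using \<open>e > 0\<close> M by (simp add: e'_def)
  obtain r where r: "r > 0" "ball z r \<subseteq> S" using S openE by blast
  obtain d where d: "d > 0"
    "\<And>y. norm (y - z) < d \<Longrightarrow> norm (f' y - f' z - f'' (y - z)) \<le> e' * norm (y - z)"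
    using f'' e' unfolding has_derivative_at_alt by blast
  define d' where "d' = min r d / M"
  have "d' > 0" using r d M by (simp add: d'_def)
  have main: "\<bar>f (z + t *\<^sub>R h + t *\<^sub>R k) - f (z + t *\<^sub>R h) - f (z + t *\<^sub>R k) + f z - t\<^sup>2 * f'' k h\<bar>
           \<le> e * t\<^sup>2" if t: "0 < t" "t < d'" for t
  proof -
    have tM: "t * M < r" "t * M < d" using t M by (auto simp: d'_def field_simps)
    have bd: "norm (s *\<^sub>R (t *\<^sub>R h) + c *\<^sub>R (t *\<^sub>R k)) \<le> t * M"
      if "0 \<le> s" "s \<le> 1" "0 \<le> c" "c \<le> 1" for s c
    proof -
      have "norm (s *\<^sub>R (t *\<^sub>R h) + c *\<^sub>R (t *\<^sub>R k)) \<le> s * (t * norm h) + c * (t * norm k)"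
        using norm_triangle_ineq[of "s *\<^sub>R (t *\<^sub>R h)" "c *\<^sub>R (t *\<^sub>R k)"] that t by simp
      also have "\<dots> \<le> 1 * (t * norm h) + 1 * (t * norm k)"
        using that t by (intro add_mono mult_right_mono) auto
      also have "\<dots> \<le> t * M" using t M by (simp add: distrib_left[symmetric])
      finally show ?thesis .
    qed
    define P where "P s c = z + (s *\<^sub>R (t *\<^sub>R h) + c *\<^sub>R (t *\<^sub>R k))" for s c :: real
    have inS: "P s c \<in> S" if "0 \<le> s" "s \<le> 1" "0 \<le> c" "c \<le> 1" for s c
    proof -
      have "dist z (P s c) = norm (s *\<^sub>R (t *\<^sub>R h) + c *\<^sub>R (t *\<^sub>R k))"
        unfolding P_def dist_norm by (subst norm_minus_commute) (simp del: scaleR_scaleR)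
      with bd[OF that] tM r show ?thesis by (auto simp del: scaleR_scaleR)
    qed
    \<comment> \<open>The second difference is \<open>g 1 - g 0\<close>. The mean value theorem
      along \<open>h\<close> turns it into a difference of values of \<open>f'\<close>, so
      differentiability of \<open>f'\<close> at the single point \<open>z\<close> suffices.\<close>
    define g where "g s = f (P s 1) - f (P s 0)" for s
    have g': "(g has_derivative (\<lambda>x. x * (t * (f' (P s 1) h - f' (P s 0) h)))) (at s)"
      if "0 \<le> s" "s \<le> 1" for s
    proof -
      have "((\<lambda>s. P s c) has_derivative (\<lambda>x. x *\<^sub>R (t *\<^sub>R h))) (at s)" for c
        unfolding P_def by (auto intro!: derivative_eq_intros)
      from has_derivative_compose[OF this f'[OF inS[OF that]]]
      have "((\<lambda>s. f (P s c)) has_derivative (\<lambda>x. f' (P s c) (x *\<^sub>R (t *\<^sub>R h)))) (at s)"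
        if "0 \<le> c" "c \<le> 1" for c using that by blast
      from has_derivative_diff[OF this[of 1] this[of 0]] show ?thesis
        unfolding g_def by (simp add: blinfun.scaleR_right right_diff_distrib mult.assoc)
    qed
    obtain s where s: "0 < s" "s < 1" "g 1 - g 0 = t * (f' (P s 1) h - f' (P s 0) h)"
    proof -
      have "\<exists>x\<in>{0<..<1}. g 1 - g 0 = (\<lambda>x'. x' * (t * (f' (P x 1) h - f' (P x 0) h))) (1 - 0)"
        by (rule mvt_simple[OF zero_less_one]) (rule has_derivative_at_withinI, rule g', simp_all)
      then show ?thesis using that by auto
    qed
    have approx: "norm (f' (P s c) - f' z - f'' (P s c - z)) \<le> e' * (t * M)" if "0 \<le> c" "c \<le> 1" for c
    proof -
      have b: "norm (P s c - z) \<le> t * M" using bd[of s c] s that by (simp add: P_def)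
      then have "norm (f' (P s c) - f' z - f'' (P s c - z)) \<le> e' * norm (P s c - z)"
        using d(2) tM by simp
      also have "\<dots> \<le> e' * (t * M)" using b e' by simp
      finally show ?thesis .
    qed
    \<comment> \<open>The points \<open>P s 1\<close> and \<open>P s 0\<close> differ by
      \<open>t *\<^sub>R k\<close>, so the unknown intermediate \<open>s\<close> drops out of the
      main term and survives only in the errors.\<close>
    have "f'' (P s 1 - z) - f'' (P s 0 - z) = t *\<^sub>R f'' k"
      by (simp add: P_def blinfun.add_right blinfun.scaleR_right)
    then have eq: "f' (P s 1) - f' (P s 0) - t *\<^sub>R f'' k
        = (f' (P s 1) - f' z - f'' (P s 1 - z)) - (f' (P s 0) - f' z - f'' (P s 0 - z))"
      by (simp add: algebra_simps)
    have "norm (f' (P s 1) - f' (P s 0) - t *\<^sub>R f'' k) \<le> e' * (t * M) + e' * (t * M)"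
      unfolding eq by (rule order_trans[OF norm_triangle_ineq4 add_mono[OF approx approx]]) simp_all
    then have n: "norm (f' (P s 1) - f' (P s 0) - t *\<^sub>R f'' k) \<le> 2 * e' * t * M"
      by (simp add: mult_ac)
    have "\<bar>(f' (P s 1) - f' (P s 0) - t *\<^sub>R f'' k) h\<bar> \<le> (2 * e' * t * M) * M"
      unfolding real_norm_def[symmetric]
      by (rule order_trans[OF norm_blinfun mult_mono[OF n M(2)]]) (use e' t M in auto)
    moreover have "g 1 - g 0 - t\<^sup>2 * f'' k h = t * (f' (P s 1) - f' (P s 0) - t *\<^sub>R f'' k) h"
      using s(3) by (simp add: blinfun.diff_left blinfun.scaleR_left blinfun.add_left algebra_simps power2_eq_square)
    ultimately have "\<bar>g 1 - g 0 - t\<^sup>2 * f'' k h\<bar> \<le> t * ((2 * e' * t * M) * M)"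
      using t by (simp add: abs_mult)
    also have "\<dots> = e * t\<^sup>2" using M by (simp add: e'_def power2_eq_square)
    finally show ?thesis by (simp add: g_def P_def add.assoc algebra_simps)
  qed
  then show ?thesis using \<open>d' > 0\<close> unfolding eventually_at_right_field by auto
qed

lemma symmetric_second_derivative:
  fixes f :: "'a::real_normed_vector \<Rightarrow> real" and f' :: "'a \<Rightarrow> 'a \<Rightarrow>\<^sub>L real"
  assumes S: "open S" "z \<in> S"
    and f': "\<And>x. x \<in> S \<Longrightarrow> (f has_derivative blinfun_apply (f' x)) (at x)"
    and f'': "(f' has_derivative blinfun_apply f'') (at z)"
  shows "f'' h k = f'' k h"
proof -
  have "\<bar>f'' h k - f'' k h\<bar> \<le> e" if "e > 0" for e
  proof -
    from that have e: "e / 2 > 0" by simp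
    have A: "eventually (\<lambda>t. \<bar>f (z + t *\<^sub>R h + t *\<^sub>R k) - f (z + t *\<^sub>R h) - f (z + t *\<^sub>R k) + f z
        - t\<^sup>2 * f'' k h\<bar> \<le> e / 2 * t\<^sup>2) (at_right 0)" for h k
      by (rule second_difference_approx[OF S _ f'' e]) (rule f')
    have "eventually (\<lambda>t::real. t > 0) (at_right 0)" by (simp add: eventually_at_right_less)
    with A[of h k] A[of k h] have "eventually (\<lambda>t. \<bar>f'' h k - f'' k h\<bar> \<le> e) (at_right (0::real))"
    proof eventually_elim
      case (elim t)
      have "z + t *\<^sub>R k + t *\<^sub>R h = z + t *\<^sub>R h + t *\<^sub>R k" by simp
      with elim have "\<bar>t\<^sup>2 * f'' h k - t\<^sup>2 * f'' k h\<bar> \<le> e * t\<^sup>2" by (simp only:)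
      then have "t\<^sup>2 * \<bar>f'' h k - f'' k h\<bar> \<le> t\<^sup>2 * e"
        unfolding right_diff_distrib[symmetric] abs_mult by (simp add: mult.commute)
      then show ?case using elim(3) by simp
    qed
    \<comment> \<open>The inequality no longer mentions \<open>t\<close>, and
      \<open>at_right 0\<close> is a nontrivial filter, so holding eventually means holding.\<close>
    then show ?thesis by (simp add: eventually_const)
  qed
  then have "\<bar>f'' h k - f'' k h\<bar> \<le> 0" by (rule field_le_epsilon[where y=0, simplified])
  then show ?thesis by simp
qed

section \<open>The Schwarz-Pick lemma for the disk and the strip\<close>

lemma Moebius_function_has_field_derivative:
  assumes "1 - cnj w * z \<noteq> 0"
  shows "(Moebius_function 0 w has_field_derivative (1 - (cmod w)\<^sup>2) / (1 - cnj w * z)\<^sup>2) (at z)"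
proof -
  have "cnj w * w = (cmod w)\<^sup>2"
    by (metis complex_norm_square mult.commute)
  then show ?thesis unfolding Moebius_function_simple[abs_def] using assms
    by (auto intro!: derivative_eq_intros simp: power2_eq_square algebra_simps)
qed

text \<open>Compose \<open>f\<close> with the disk automorphisms that carry 0 to \<open>z\<close>
  and \<open>f z\<close> to 0, and apply the Schwarz lemma at the origin. The factors in the
  estimate come from their derivatives: \<open>1 - (cmod z)^2\<close> at 0 for the first, and the
  reciprocal of \<open>1 - (cmod (f z))^2\<close> at \<open>f z\<close> for the second.\<close>

lemma Schwarz_Pick_deriv:
  assumes f: "f holomorphic_on ball 0 1" "f \<in> ball 0 1 \<rightarrow> ball 0 1" and z: "z \<in> ball 0 1"
  shows "cmod (deriv f z) * (1 - (cmod z)\<^sup>2) \<le> 1 - (cmod (f z))\<^sup>2"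
proof -
  have fz: "cmod (f z) < 1" using f(2) z by auto
  have z1: "cmod z < 1" using z by simp
  let ?A = "Moebius_function 0 (- z)" and ?B = "Moebius_function 0 (f z)"
  define g where "g = (\<lambda>x. ?B (f (?A x)))"
  have A0: "?A 0 = z" by (simp add: Moebius_function_of_zero)
  have A1: "cmod (?A x) < 1" if "cmod x < 1" for x
    using Moebius_function_norm_lt_1[of "- z" x 0] z1 that by simp
  have fA: "cmod (f (?A x)) < 1" if "cmod x < 1" for x
    using f(2) A1[OF that] by (auto simp: Pi_iff)
  have "g holomorphic_on ball 0 1"
  proof -
    have 1: "?A holomorphic_on ball 0 1" using z1 by (intro Moebius_function_holomorphic) simp
    have 2: "(f \<circ> ?A) holomorphic_on ball 0 1"
      by (rule holomorphic_on_compose_gen[OF 1 f(1)]) (auto simp: A1)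
    have "(?B \<circ> (f \<circ> ?A)) holomorphic_on ball 0 1"
      by (rule holomorphic_on_compose_gen[OF 2 Moebius_function_holomorphic[OF fz]]) (auto simp: fA)
    then show ?thesis by (simp add: g_def o_def)
  qed
  moreover have "g 0 = 0" by (simp add: g_def A0 Moebius_function_eq_zero)
  moreover have "cmod (g x) < 1" if "cmod x < 1" for x
    unfolding g_def using Moebius_function_norm_lt_1[OF fz fA[OF that]] .
  ultimately have le: "cmod (deriv g 0) \<le> 1"
    using Schwarz_Lemma(2)[of g 0] by auto
  define a where "a = complex_of_real (1 - (cmod z)\<^sup>2)"
  define b where "b = complex_of_real (1 - (cmod (f z))\<^sup>2)"
  have pos: "1 - (cmod (f z))\<^sup>2 > 0" "1 - (cmod z)\<^sup>2 > 0"
    using fz z1 by (simp_all add: power_less_one_iff abs_square_less_1)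
  have b0: "b \<noteq> 0" using pos by (simp add: b_def del: of_real_diff)
  have "cnj (f z) * f z = (cmod (f z))\<^sup>2"
    by (metis complex_norm_square mult.commute)
  then have bb: "1 - cnj (f z) * f z = b" by (simp add: b_def)
  have dA: "(?A has_field_derivative a) (at 0)"
    using Moebius_function_has_field_derivative[of "- z" 0] by (simp add: a_def)
  have "(?B has_field_derivative b / b\<^sup>2) (at (f z))"
    using Moebius_function_has_field_derivative[of "f z" "f z"] b0 unfolding bb by (simp add: b_def)
  then have dB: "(?B has_field_derivative inverse b) (at (f z))"
    using b0 by (simp add: power2_eq_square field_simps)
  have "(f has_field_derivative deriv f z) (at z)"
    using f(1) z holomorphic_derivI by blast
  then have "(g has_field_derivative inverse b * (deriv f z * a)) (at 0)"
    unfolding g_def using dA dB by (intro DERIV_chain2) (simp_all add: A0)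
  then have "deriv g 0 = inverse b * (deriv f z * a)" by (rule DERIV_imp_deriv)
  moreover have "cmod a = 1 - (cmod z)\<^sup>2" "cmod b = 1 - (cmod (f z))\<^sup>2"
    using pos unfolding a_def b_def norm_of_real by simp_all
  ultimately have "cmod (deriv f z) * (1 - (cmod z)\<^sup>2) / (1 - (cmod (f z))\<^sup>2) \<le> 1"
    using le by (simp add: norm_mult norm_inverse divide_inverse mult.commute)
  then show ?thesis using pos by (simp add: pos_divide_le_eq)
qed

section \<open>Transfer of the estimate from the disk to the strip\<close>

text \<open>By the double angle formula the claim for nonnegative \<open>x\<close> amounts to
  \<open>x * sqrt 2 \<le> 2 * sin (x * pi / 4)\<close>: on \<open>{0..pi/4}\<close> the concave sine
  lies above its chord. Negative \<open>x\<close> follow because both sides are even.\<close>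

lemma cos_half_pi_le:
  fixes x :: real
  assumes "\<bar>x\<bar> \<le> 1"
  shows "cos (pi * x / 2) \<le> 1 - x\<^sup>2"
proof -
  have *: "cos (pi * x / 2) \<le> 1 - x\<^sup>2" if x: "0 \<le> x" "x \<le> 1" for x :: real
  proof -
    have "concave_on {0..pi/4} (\<lambda>x. sin x)"
    proof (rule f''_le0_imp_concave)
      show "(sin has_real_derivative cos x) (at x)" for x by (rule DERIV_sin)
      show "(cos has_real_derivative - sin x) (at x)" for x by (rule DERIV_cos)
    qed (auto intro!: sin_ge_zero)
    from concave_onD[OF this, of x 0 "pi / 4"] x
    have "x * sqrt 2 \<le> 2 * sin (x * pi / 4)"
      by (simp add: sin_45 field_simps)
    then have "(x * sqrt 2)\<^sup>2 \<le> (2 * sin (x * pi / 4))\<^sup>2"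
      using x by (intro power_mono) auto
    moreover have "cos (pi * x / 2) = 1 - 2 * (sin (x * pi / 4))\<^sup>2"
      using cos_double_sin[of "x * pi / 4"] by (simp add: field_simps)
    ultimately show ?thesis by (simp add: power_mult_distrib)
  qed
  show ?thesis
  proof (cases "x \<ge> 0")
    case False
    with *[of "- x"] assms show ?thesis by simp
  qed (use * assms in auto)
qed

text \<open>With \<open>u = pi/4 * F\<close>, both the derivative of \<open>tan\<close> at
  \<open>u z\<close> and \<open>1 - (cmod (tan (u z)))^2\<close> carry the denominator
  \<open>(cmod (cos (u z)))^2\<close>. It cancels in the Schwarz-Pick inequality and leaves only the
  cosine of a real number.\<close>

lemma strip_Schwarz_Pick:
  assumes F: "F holomorphic_on ball 0 1" and Re: "\<And>z. z \<in> ball 0 1 \<Longrightarrow> \<bar>Re (F z)\<bar> < 1"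
    and z: "z \<in> ball 0 1"
  shows "cmod (deriv F z) * (1 - (cmod z)\<^sup>2) \<le> 4 / pi * cos (pi * Re (F z) / 2)"
proof -
  define u where "u z = complex_of_real (pi / 4) * F z" for z
  have diff: "(cmod (cos w))\<^sup>2 - (cmod (sin w))\<^sup>2 = cos (2 * Re w)" for w
  proof -
    have "(exp (Im w) - inverse (exp (Im w)))\<^sup>2 = exp (2 * Im w) + inverse (exp (2 * Im w)) - 2"
      by (simp add: power2_diff exp_double power_inverse)
    \<comment> \<open>This is the shape after expanding the moduli of cosine and sine:
      \<open>X\<close> is the square of \<open>exp (Im w) - inverse (exp (Im w))\<close>,
      \<open>A\<close> is \<open>exp (2 * Im w)\<close> plus its inverse, and \<open>c\<close>,
      \<open>s\<close> are the squared cosine and sine of \<open>Re w\<close>. The exponentials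
      cancel.\<close>
    moreover have "c + X / 4 - (A - 2 * (c - s)) / 4 = c - s"
      if "X = A - 2" "s + c = 1" for A X c s :: real
      using that by argo
    ultimately show ?thesis
      unfolding norm_cos_squared norm_sin_squared cos_double
      using sin_cos_squared_add[of "Re w"] by blast
  qed
  \<comment> \<open>The scaling by \<open>pi / 4\<close> puts \<open>2 * Re (u w)\<close> strictly
    between \<open>-pi/2\<close> and \<open>pi/2\<close>. By \<open>diff\<close>, positivity then
    excludes zeros of \<open>cos (u w)\<close> and gives \<open>cmod (G w) < 1\<close>.\<close>
  have pos: "cos (2 * Re (u w)) > 0" if "w \<in> ball 0 1" for w
    using Re[OF that] mult_strict_left_mono[of "- 1" "Re (F w)" pi]
    by (intro cos_gt_zero_pi) (simp_all add: u_def abs_less_iff)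
  have cos0: "cos (u w) \<noteq> 0" if "w \<in> ball 0 1" for w
  proof
    assume "cos (u w) = 0"
    then have "cos (2 * Re (u w)) = - (cmod (sin (u w)))\<^sup>2" using diff[of "u w"] by simp
    with pos[OF that] show False by simp
  qed
  define G where "G w = tan (u w)" for w
  have ratio: "1 - (cmod (G w))\<^sup>2 = cos (2 * Re (u w)) / (cmod (cos (u w)))\<^sup>2" if "w \<in> ball 0 1" for w
    using cos0[OF that] diff[of "u w", symmetric]
    by (simp add: G_def tan_def norm_divide power_divide diff_divide_distrib)
  have "cmod (G w) < 1" if "w \<in> ball 0 1" for w
  proof -
    have "(cmod (G w))\<^sup>2 < 1" using ratio[OF that] pos[OF that] cos0[OF that]
      by (metis diff_gt_0_iff_gt divide_pos_pos zero_less_norm_iff zero_less_power)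
    then show ?thesis by (simp add: abs_square_less_1)
  qed
  then have Gim: "G \<in> ball 0 1 \<rightarrow> ball 0 1" by auto
  have dG: "(G has_field_derivative (inverse ((cos (u w))\<^sup>2)) * (of_real (pi / 4) * deriv F w)) (at w)"
    if "w \<in> ball 0 1" for w
  proof -
    have "(F has_field_derivative deriv F w) (at w)"
      using F that holomorphic_derivI by blast
    then have "(u has_field_derivative of_real (pi / 4) * deriv F w) (at w)"
      unfolding u_def by (rule DERIV_cmult)
    with DERIV_tan[OF cos0[OF that]] show ?thesis
      unfolding G_def by (rule DERIV_chain2[of tan _ u])
  qed
  have "G holomorphic_on ball 0 1"
    by (rule holomorphic_onI) (meson dG field_differentiable_at_within field_differentiable_def)
  from Schwarz_Pick_deriv[OF this Gim z]
  have "cmod (deriv G z) * (1 - (cmod z)\<^sup>2) \<le> cos (2 * Re (u z)) / (cmod (cos (u z)))\<^sup>2"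
    by (simp add: ratio[OF z])
  moreover have "cmod (deriv G z) = (pi / 4 * cmod (deriv F z)) / (cmod (cos (u z)))\<^sup>2"
    using DERIV_imp_deriv[OF dG[OF z]] by (simp add: norm_mult norm_inverse norm_power norm_divide field_simps)
  ultimately have "(pi / 4 * cmod (deriv F z) * (1 - (cmod z)\<^sup>2)) / (cmod (cos (u z)))\<^sup>2
      \<le> cos (2 * Re (u z)) / (cmod (cos (u z)))\<^sup>2" by (simp only: times_divide_eq_left)
  then have "pi / 4 * cmod (deriv F z) * (1 - (cmod z)\<^sup>2) \<le> cos (2 * Re (u z))"
    using cos0[OF z] by (simp only: divide_le_cancel) simp
  then show ?thesis by (simp add: u_def field_simps)
qed

section \<open>The hyperbolic density\<close>

text \<open>A covering map is injective near each point, and an injective holomorphic map on an open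
  set has no critical point.\<close>

lemma covering_deriv_nonzero:
  assumes "universal_covering p D" "z \<in> ball 0 1"
  shows "deriv p z \<noteq> 0"
proof -
  have p: "p holomorphic_on ball 0 1" "covering_space (ball 0 1) p D"
    using assms by (auto simp: universal_covering_def)
  obtain T u q where T: "z \<in> T" "openin (top_of_set (ball 0 1)) T" "homeomorphism T u p q"
    using covering_space_local_homeomorphism[OF p(2) assms(2)] by metis
  have "open T" "T \<subseteq> ball 0 1"
    using T(2) by (auto simp: openin_open_eq)
  moreover have "inj_on p T"
    using T(3) by (metis homeomorphism_def inj_on_inverseI)
  ultimately show ?thesis
    using holomorphic_injective_imp_regular holomorphic_on_subset p(1) T(1) by blast
qed

section \<open>Holomorphic lifts and invariance of the density under change of covering\<close>

text \<open>Simple connectivity provides a continuous lift. It is holomorphic because near each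
  point it equals \<open>f\<close> followed by a local inverse of \<open>q\<close>, and that inverse
  is differentiable since \<open>deriv q\<close> does not vanish.\<close>

lemma covering_lift_holomorphic:
  assumes q: "universal_covering q D" and f: "f holomorphic_on S" "f ` S \<subseteq> D"
    and S: "open S" "simply_connected S"
    and ab: "a \<in> S" "b \<in> ball 0 1" "f a = q b"
  obtains h where "h holomorphic_on S" "h \<in> S \<rightarrow> ball 0 1" "h a = b" "\<And>z. z \<in> S \<Longrightarrow> q (h z) = f z"
proof -
  have q': "q holomorphic_on ball 0 1" "covering_space (ball 0 1) q D"
    using q by (auto simp: universal_covering_def)
  obtain h where h: "continuous_on S h" "h \<in> S \<rightarrow> ball 0 1" "h a = b" "\<And>z. z \<in> S \<Longrightarrow> q (h z) = f z"
    using covering_space_lift_strong[OF q'(2) ab(2,1) S(2) open_imp_locally_path_connected[OF S(1)]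
        holomorphic_on_imp_continuous_on[OF f(1)]] f(2) ab(3) by blast
  have "h field_differentiable (at z)" if z: "z \<in> S" for z
  proof -
    have hz: "h z \<in> ball 0 1" using h(2) z by blast
    obtain T u r where T: "h z \<in> T" "openin (top_of_set (ball 0 1)) T" "homeomorphism T u q r"
      using covering_space_local_homeomorphism[OF q'(2) hz] by metis
    have T': "open T" "T \<subseteq> ball 0 1" using T(2) by (auto simp: openin_open_eq)
    have rq: "r (q x) = x" if "x \<in> T" for x using T(3) that by (simp add: homeomorphism_def)
    \<comment> \<open>On \<open>V\<close> the lift stays in the single sheet \<open>T\<close>, where
      \<open>r\<close> inverts \<open>q\<close>; hence \<open>h\<close> agrees there with
      \<open>r\<close> after \<open>f\<close>.\<close>
    define V where "V = S \<inter> h -` T"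
    have "open V" using h(1) S(1) T'(1) continuous_on_open_vimage V_def
      by (metis Int_commute)
    have "z \<in> V" using z T by (simp add: V_def)
    have "(r has_field_derivative inverse (deriv q (h z))) (at (q (h z)))"
    proof (rule has_field_derivative_inverse_strong[OF _ _ T'(1) T(1)])
      show "DERIV q (h z) :> deriv q (h z)"
        using q'(1) hz holomorphic_derivI by blast
      show "deriv q (h z) \<noteq> 0" using covering_deriv_nonzero[OF q hz] .
      show "continuous_on T q"
        using q'(1) T'(2) holomorphic_on_imp_continuous_on continuous_on_subset by blast
    qed (use rq in auto)
    moreover have "(f has_field_derivative deriv f z) (at z)"
      using f(1) S(1) z holomorphic_derivI by blast
    ultimately have "((\<lambda>x. r (f x)) has_field_derivative inverse (deriv q (h z)) * deriv f z) (at z)"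
      using h(4)[OF z] by (intro DERIV_chain2) simp_all
    then have "(h has_field_derivative inverse (deriv q (h z)) * deriv f z) (at z)"
      by (rule has_field_derivative_transform_within_open[OF _ \<open>open V\<close> \<open>z \<in> V\<close>])
        (use rq h(4) in \<open>auto simp: V_def simp flip: h(4)\<close>)
    then show ?thesis using field_differentiable_def by blast
  qed
  then have "h holomorphic_on S"
    by (auto intro: holomorphic_onI field_differentiable_at_within)
  with h that show thesis by blast
qed

text \<open>Lifting \<open>p\<close> through \<open>q\<close> gives a holomorphic self-map
  \<open>h\<close> of the disk with \<open>h a = b\<close>. Schwarz-Pick for \<open>h\<close>
  combines with the chain rule \<open>deriv p a = deriv q b * deriv h a\<close>.\<close>

lemma universal_covering_deriv_le:
  assumes p: "universal_covering p D" and q: "universal_covering q D"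
    and ab: "a \<in> ball 0 1" "b \<in> ball 0 1" "p a = q b"
  shows "cmod (deriv p a) * (1 - (cmod a)\<^sup>2) \<le> cmod (deriv q b) * (1 - (cmod b)\<^sup>2)"
proof -
  have p': "p holomorphic_on ball 0 1" "p ` ball 0 1 = D"
    using p by (auto simp: universal_covering_def covering_space_imp_surjective)
  have q': "q holomorphic_on ball 0 1"
    using q by (auto simp: universal_covering_def)
  obtain h where h: "h holomorphic_on ball 0 1" "h \<in> ball 0 1 \<rightarrow> ball 0 1" "h a = b"
      "\<And>z. z \<in> ball 0 1 \<Longrightarrow> q (h z) = p z"
    using covering_lift_holomorphic[OF q p'(1) _ open_ball convex_imp_simply_connected[OF convex_ball] ab]
      p'(2) by blast
  have "((\<lambda>x. q (h x)) has_field_derivative deriv q b * deriv h a) (at a)"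
    using q' h ab by (intro DERIV_chain2) (auto intro: holomorphic_derivI)
  then have "(p has_field_derivative deriv q b * deriv h a) (at a)"
    by (rule has_field_derivative_transform_within_open[OF _ open_ball ab(1)]) (rule h(4))
  then have "deriv p a = deriv q b * deriv h a" by (rule DERIV_imp_deriv)
  moreover have "cmod (deriv q b) * (cmod (deriv h a) * (1 - (cmod a)\<^sup>2)) \<le> cmod (deriv q b) * (1 - (cmod b)\<^sup>2)"
    using Schwarz_Pick_deriv[OF h(1,2) ab(1)] h(3) by (intro mult_left_mono) auto
  ultimately show ?thesis by (simp add: norm_mult mult.assoc)
qed

text \<open>This justifies the definite description in \<open>hyp_density\<close>. The preceding
  inequality, used in both directions, shows that \<open>cmod (deriv p a) * (1 - (cmod a)^2)\<close>
  is the same for all coverings and preimages; nonvanishing of the derivative makes the value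
  unique.\<close>

lemma hyp_density_covering:
  assumes p: "universal_covering p D" and a: "a \<in> ball 0 1"
  shows "hyp_density D (p a) = 2 / (cmod (deriv p a) * (1 - (cmod a)\<^sup>2))"
  unfolding hyp_density_def
proof (rule the_equality)
  have pos: "1 - (cmod b)\<^sup>2 > 0" if "b \<in> ball 0 1" for b :: complex
    using that by (simp add: abs_square_less_1)
  show "\<forall>q z. universal_covering q D \<and> z \<in> ball 0 1 \<and> q z = p a \<longrightarrow>
      2 / (cmod (deriv p a) * (1 - (cmod a)\<^sup>2)) * cmod (deriv q z) = 2 / (1 - (cmod z)\<^sup>2)"
  proof (intro allI impI)
    fix q z assume q: "universal_covering q D \<and> z \<in> ball 0 1 \<and> q z = p a"
    then have "cmod (deriv p a) * (1 - (cmod a)\<^sup>2) = cmod (deriv q z) * (1 - (cmod z)\<^sup>2)"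
      using universal_covering_deriv_le[OF p _ a, of q z] universal_covering_deriv_le[OF _ p _ a, of q z]
      by auto
    then show "2 / (cmod (deriv p a) * (1 - (cmod a)\<^sup>2)) * cmod (deriv q z) = 2 / (1 - (cmod z)\<^sup>2)"
      using covering_deriv_nonzero[of q D z] q by simp
  qed
  fix r assume "\<forall>q z. universal_covering q D \<and> z \<in> ball 0 1 \<and> q z = p a \<longrightarrow>
      r * cmod (deriv q z) = 2 / (1 - (cmod z)\<^sup>2)"
  then have "r * cmod (deriv p a) = 2 / (1 - (cmod a)\<^sup>2)" using p a by blast
  then show "r = 2 / (cmod (deriv p a) * (1 - (cmod a)\<^sup>2))"
    using covering_deriv_nonzero[OF p a] pos[OF a] by (simp add: field_simps)
qed

lemma hyp_density_pos:
  assumes "hyperbolic_domain D" "w \<in> D"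
  shows "hyp_density D w > 0"
proof -
  obtain p where p: "universal_covering p D" using assms by (auto simp: hyperbolic_domain_def)
  with assms(2) obtain a where a: "a \<in> ball 0 1" "w = p a"
    by (metis covering_space_imp_surjective imageE universal_covering_def)
  then show ?thesis
    using hyp_density_covering[OF p a(1)] covering_deriv_nonzero[OF p a(1)]
    by (simp add: abs_square_less_1)
qed

lemma universal_covering_id: "universal_covering (\<lambda>z. z) (ball 0 1)"
proof -
  have "covering_space (ball 0 1) (\<lambda>z. z) (ball (0::complex) 1)"
    by (rule homeomorphism_imp_covering_space[where g="\<lambda>z. z"]) (simp add: homeomorphism_def)
  then show ?thesis by (simp add: universal_covering_def)
qed

lemma hyperbolic_domain_disk: "hyperbolic_domain (ball 0 1)"
  using universal_covering_id by (auto simp: hyperbolic_domain_def)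

lemma hyp_density_disk:
  assumes "z \<in> ball 0 1"
  shows "hyp_density (ball 0 1) z = 2 / (1 - (cmod z)\<^sup>2)"
  using hyp_density_covering[OF universal_covering_id assms] by simp

text \<open>Near each point the covering has a continuous local inverse \<open>q\<close>, and the
  density is the explicit formula of \<open>hyp_density_covering\<close> evaluated at
  \<open>q y\<close>.\<close>

lemma continuous_on_hyp_density:
  assumes "hyperbolic_domain D"
  shows "continuous_on D (hyp_density D)"
proof -
  obtain p where p: "universal_covering p D" and D: "open D"
    using assms by (auto simp: hyperbolic_domain_def)
  have p': "p holomorphic_on ball 0 1" "covering_space (ball 0 1) p D"
    using p by (auto simp: universal_covering_def)
  have "continuous (at w) (hyp_density D)" if w: "w \<in> D" for w
  proof -
    obtain x T U q where T: "p x = w" "x \<in> T" "openin (top_of_set (ball 0 1)) T"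
        "w \<in> U" "openin (top_of_set D) U" "homeomorphism T U p q"
      using covering_space_local_homeomorphism_alt[OF p'(2) w] by metis
    have U: "open U" using T(5) D by (simp add: openin_open_eq)
    have T': "T \<subseteq> ball 0 1" using T(3) by (rule openin_imp_subset)
    have q: "continuous_on U q" "q ` U \<subseteq> ball 0 1" "\<And>y. y \<in> U \<Longrightarrow> p (q y) = y"
      using T(6) T' by (auto simp: homeomorphism_def)
    have "continuous_on (ball 0 1) (deriv p)"
      using p'(1) by (simp add: holomorphic_deriv holomorphic_on_imp_continuous_on)
    then have dpq: "continuous_on U (\<lambda>y. deriv p (q y))"
      using continuous_on_compose2 q(1,2) by blast
    have "continuous_on U (\<lambda>y. 2 / (cmod (deriv p (q y)) * (1 - (cmod (q y))\<^sup>2)))"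
    proof (intro continuous_intros dpq q(1) ballI)
      fix y assume "y \<in> U"
      then have "q y \<in> ball 0 1" using q(2) by blast
      then show "cmod (deriv p (q y)) * (1 - (cmod (q y))\<^sup>2) \<noteq> 0"
        using covering_deriv_nonzero[OF p, of "q y"] abs_square_less_1[of "cmod (q y)"] by auto
    qed
    moreover have "hyp_density D y = 2 / (cmod (deriv p (q y)) * (1 - (cmod (q y))\<^sup>2))" if "y \<in> U" for y
      using hyp_density_covering[OF p, of "q y"] q(2,3) that by (metis image_subset_iff)
    ultimately have "continuous_on U (hyp_density D)"
      using continuous_on_cong[OF refl] by force
    then show ?thesis using U T(4) continuous_on_eq_continuous_at by blast
  qed
  then show ?thesis using continuous_at_imp_continuous_on by blast
qed

section \<open>Gradients of harmonic functions\<close>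

text \<open>The function is \<open>f = v_x - \<i> * v_y\<close>, whose modulus is the length of the
  gradient. Its Cauchy-Riemann equations are the Laplace equation and the symmetry of the second
  derivative. Unlike a harmonic conjugate of \<open>v\<close>, it exists on all of \<open>D\<close>
  even when \<open>D\<close> is not simply connected.\<close>

lemma harmonic_gradient:
  assumes D: "open D" and v: "real_harmonic_on v D"
  obtains f where "f holomorphic_on D" "\<And>z. z \<in> D \<Longrightarrow> (v has_derivative (\<lambda>h. Re (f z * h))) (at z)"
proof -
  obtain v' :: "complex \<Rightarrow> complex \<Rightarrow>\<^sub>L real" and v'' :: "complex \<Rightarrow> complex \<Rightarrow>\<^sub>L complex \<Rightarrow>\<^sub>L real"
    where v': "\<And>z. z \<in> D \<Longrightarrow> (v has_derivative blinfun_apply (v' z)) (at z)"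
      and v'': "\<And>z. z \<in> D \<Longrightarrow> (v' has_derivative blinfun_apply (v'' z)) (at z)"
      and lap: "\<And>z. z \<in> D \<Longrightarrow> v'' z 1 1 + v'' z \<i> \<i> = 0"
    using v unfolding real_harmonic_on_def by blast
  \<comment> \<open>A real-linear map is determined by its values at 1 and \<open>\<i>\<close>. The
    target type is left general because the fact serves both \<open>v' z\<close> and
    \<open>v'' z\<close>.\<close>
  have split: "T h = Re h *\<^sub>R T 1 + Im h *\<^sub>R T \<i>" for T :: "complex \<Rightarrow>\<^sub>L 'b::real_normed_vector" and h
  proof -
    have "h = Re h *\<^sub>R 1 + Im h *\<^sub>R \<i>" by (simp add: complex_eq_iff)
    then show ?thesis by (metis blinfun.add_right blinfun.scaleR_right)
  qed
  define f where "f z = Complex (v' z 1) (- v' z \<i>)" for z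
  have "(f has_field_derivative Complex (v'' z 1 1) (- v'' z 1 \<i>)) (at z)" if z: "z \<in> D" for z
  proof -
    have sym: "v'' z \<i> 1 = v'' z 1 \<i>"
      by (rule symmetric_second_derivative[OF D z _ v''[OF z]]) (rule v')
    have 1: "((\<lambda>z. v' z a) has_derivative (\<lambda>h. v'' z h a)) (at z)" for a
      using bounded_linear.has_derivative[OF blinfun.bounded_linear_left v''[OF z]] .
    have "((\<lambda>z. complex_of_real (v' z 1) - \<i> * complex_of_real (v' z \<i>)) has_derivative
        (\<lambda>h. complex_of_real (v'' z h 1) - \<i> * complex_of_real (v'' z h \<i>))) (at z)"
      by (intro derivative_intros 1)
    moreover have "(\<lambda>z. complex_of_real (v' z 1) - \<i> * complex_of_real (v' z \<i>)) = f"
      by (auto simp: f_def complex_eq_iff)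
    \<comment> \<open>Complex linearity of the real derivative. The direction 1 is immediate; the
      direction \<open>\<i>\<close> needs \<open>sym\<close> for the real part and
      \<open>lap\<close> for the imaginary part.\<close>
    moreover have "(\<lambda>h. complex_of_real (v'' z h 1) - \<i> * complex_of_real (v'' z h \<i>))
        = (*) (Complex (v'' z 1 1) (- v'' z 1 \<i>))"
    proof
      fix h
      have "v'' z h = Re h *\<^sub>R v'' z 1 + Im h *\<^sub>R v'' z \<i>" by (rule split)
      moreover have "v'' z \<i> \<i> = - v'' z 1 1" using lap[OF z] by simp
      ultimately show "complex_of_real (v'' z h 1) - \<i> * complex_of_real (v'' z h \<i>)
          = Complex (v'' z 1 1) (- v'' z 1 \<i>) * h"
        using sym by (simp add: complex_eq_iff blinfun.add_left blinfun.scaleR_left)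
    qed
    ultimately show ?thesis by (simp add: has_field_derivative_def)
  qed
  then have "f holomorphic_on D"
    by (meson field_differentiable_at_within field_differentiable_def holomorphic_onI)
  moreover have "(v has_derivative (\<lambda>h. Re (f z * h))) (at z)" if "z \<in> D" for z
  proof -
    have "blinfun_apply (v' z) = (\<lambda>h. Re (f z * h))"
    proof
      fix h
      have "v' z h = Re h *\<^sub>R v' z 1 + Im h *\<^sub>R v' z \<i>" by (rule split)
      then show "v' z h = Re (f z * h)" by (simp add: f_def)
    qed
    with v'[OF that] show ?thesis by simp
  qed
  ultimately show thesis using that by blast
qed

text \<open>The infinitesimal form of the theorem. On the disk the pullback
  \<open>f (p z) * deriv p z\<close> has a primitive, normalized so that its real part is
  \<open>v (p z)\<close>. The strip estimate applies to it, and dividing by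
  \<open>cmod (deriv p a) * (1 - (cmod a)^2)\<close> produces the density of
  \<open>D\<close>.\<close>

lemma harmonic_gradient_bound:
  assumes D: "hyperbolic_domain D" and v: "\<And>z. z \<in> D \<Longrightarrow> v z \<in> {-1<..<1}"
    and f: "f holomorphic_on D" "\<And>z. z \<in> D \<Longrightarrow> (v has_derivative (\<lambda>h. Re (f z * h))) (at z)"
    and w: "w \<in> D"
  shows "2 / (1 - (v w)\<^sup>2) * cmod (f w) \<le> 4 / pi * hyp_density D w"
proof -
  obtain p where p: "universal_covering p D" and "open D"
    using D by (auto simp: hyperbolic_domain_def)
  have p': "p holomorphic_on ball 0 1" "p ` ball 0 1 = D"
    using p by (auto simp: universal_covering_def covering_space_imp_surjective)
  obtain a where a: "a \<in> ball 0 1" "p a = w" using w p'(2) by blast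
  have fpp: "(\<lambda>z. f (p z) * deriv p z) holomorphic_on ball 0 1"
    using p' f(1) by (intro holomorphic_intros holomorphic_on_compose_gen[OF p'(1) f(1), unfolded o_def])
      (auto intro: holomorphic_intros)
  obtain F where F: "\<And>z. z \<in> ball 0 1 \<Longrightarrow> (F has_field_derivative f (p z) * deriv p z) (at z)"
    using holomorphic_convex_primitive'[OF convex_ball open_ball fpp] by (metis at_within_open open_ball)
  have der0: "((\<lambda>z. v (p z) - Re (F z)) has_derivative (\<lambda>h. 0)) (at z)" if z: "z \<in> ball 0 1" for z
  proof -
    have "(p has_derivative (*) (deriv p z)) (at z)"
      using p'(1) z holomorphic_derivI has_field_derivative_def by (metis open_ball)
    then have 1: "((\<lambda>z. v (p z)) has_derivative (\<lambda>h. Re (f (p z) * (deriv p z * h)))) (at z)"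
      by (rule has_derivative_compose) (use f(2) p'(2) z in blast)
    have 2: "((\<lambda>z. Re (F z)) has_derivative (\<lambda>h. Re (f (p z) * deriv p z * h))) (at z)"
      using F[OF z] by (intro has_derivative_Re) (simp add: has_field_derivative_def)
    show ?thesis using has_derivative_diff[OF 1 2] by (simp add: mult.assoc)
  qed
  define c where "c = v (p 0) - Re (F 0)"
  have c: "v (p z) - Re (F z) = c" if "z \<in> ball 0 1" for z
    unfolding c_def
    by (rule has_derivative_zero_unique[OF convex_ball has_derivative_at_withinI[OF der0] that]) auto
  \<comment> \<open>A primitive is fixed only up to a constant; this choice makes the real part
    exactly \<open>v (p z)\<close>, hence within the strip.\<close>
  define H where "H z = F z + complex_of_real c" for z
  have dH: "(H has_field_derivative f (p z) * deriv p z) (at z)" if "z \<in> ball 0 1" for z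
    unfolding H_def using DERIV_add[OF F[OF that] DERIV_const] by simp
  have ReH: "Re (H z) = v (p z)" if "z \<in> ball 0 1" for z
    using c[OF that] by (simp add: H_def)
  have "H holomorphic_on ball 0 1"
    by (meson dH field_differentiable_at_within field_differentiable_def holomorphic_onI)
  moreover have "\<bar>Re (H z)\<bar> < 1" if "z \<in> ball 0 1" for z
    using v p'(2) ReH[OF that] that by fastforce
  ultimately have "cmod (deriv H a) * (1 - (cmod a)\<^sup>2) \<le> 4 / pi * cos (pi * Re (H a) / 2)"
    using a(1) by (rule strip_Schwarz_Pick)
  also have "\<dots> \<le> 4 / pi * (1 - (v w)\<^sup>2)"
    using cos_half_pi_le[of "v w"] v[OF w] ReH[OF a(1)] a(2)
    by (intro mult_left_mono) auto
  finally have le: "cmod (f w) * cmod (deriv p a) * (1 - (cmod a)\<^sup>2) \<le> 4 / pi * (1 - (v w)\<^sup>2)"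
    using DERIV_imp_deriv[OF dH[OF a(1)]] a(2) by (simp add: norm_mult)
  define A where "A = cmod (deriv p a) * (1 - (cmod a)\<^sup>2)"
  have pos: "1 - (v w)\<^sup>2 > 0" "A > 0"
    using a(1) v[OF w] covering_deriv_nonzero[OF p a(1)] by (auto simp: A_def abs_square_less_1)
  have "cmod (f w) \<le> 4 / pi * (1 - (v w)\<^sup>2) / A"
    using le pos by (simp only: A_def pos_le_divide_eq mult.assoc)
  then have "2 / (1 - (v w)\<^sup>2) * cmod (f w) \<le> 2 / (1 - (v w)\<^sup>2) * (4 / pi * (1 - (v w)\<^sup>2) / A)"
    using pos by (intro mult_left_mono) auto
  also have "\<dots> = 4 / pi * (2 / A)"
  proof -
    have "2 / X * (4 / pi * X / A) = 4 / pi * (2 / A)" if "X > 0" for X :: real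
      using that by simp
    then show ?thesis using pos(1) .
  qed
  also have "2 / A = hyp_density D w"
    using hyp_density_covering[OF p a(1)] a(2) by (simp add: A_def)
  finally show ?thesis .
qed

section \<open>Lengths and distances\<close>

text \<open>Induction on the number of points of \<open>S\<close> strictly between \<open>a\<close>
  and \<open>b\<close>: cutting at any such point leaves fewer of them on either side.\<close>

lemma integrable_on_partition:
  fixes f :: "real \<Rightarrow> 'a::banach"
  assumes "finite S"
    and "\<And>a b. a \<in> S \<Longrightarrow> b \<in> S \<Longrightarrow> a < b \<Longrightarrow> {a<..<b} \<inter> S = {} \<Longrightarrow> f integrable_on {a..b}"
    and "a \<in> S" "b \<in> S" "a \<le> b"
  shows "f integrable_on {a..b}"
  using assms(3-5)
proof (induction "card ({a<..<b} \<inter> S)" arbitrary: a b rule: less_induct)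
  case less
  show ?case
  proof (cases "a = b \<or> {a<..<b} \<inter> S = {}")
    case True
    then show ?thesis using less.prems assms(2)[of a b] integrable_on_refl[of f a]
      by (cases "a = b") auto
  next
    case False
    then obtain c where c: "c \<in> S" "a < c" "c < b" by auto
    have "{a<..<c} \<inter> S \<subset> {a<..<b} \<inter> S" "{c<..<b} \<inter> S \<subset> {a<..<b} \<inter> S"
      using c by auto
    then have "card ({a<..<c} \<inter> S) < card ({a<..<b} \<inter> S)" "card ({c<..<b} \<inter> S) < card ({a<..<b} \<inter> S)"
      using assms(1) by (auto intro!: psubset_card_mono)
    then have "f integrable_on {a..c}" "f integrable_on {c..b}"
      using less.hyps[of a c] less.hyps[of c b] less.prems c by simp_all
    then show ?thesis using c by (intro Henstock_Kurzweil_Integration.integrable_combine[of a c b]) auto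
  qed
qed

text \<open>Take the largest point of \<open>S\<close> below \<open>t\<close> and the smallest
  above; \<open>a\<close> and \<open>b\<close> ensure that both exist.\<close>

lemma partition_neighbours:
  fixes S :: "real set"
  assumes "finite S" "a \<in> S" "b \<in> S" "a \<le> t" "t \<le> b" "t \<notin> S"
  obtains c d where "c \<in> S" "d \<in> S" "c < t" "t < d" "{c<..<d} \<inter> S = {}"
proof -
  define L where "L = {s\<in>S. s < t}"
  define R where "R = {s\<in>S. t < s}"
  have L: "finite L" "L \<noteq> {}" and R: "finite R" "R \<noteq> {}"
    using assms by (auto simp: L_def R_def order.order_iff_strict)
  show thesis
  proof
    show "Max L \<in> S" "Max L < t" using Max_in[OF L] by (auto simp: L_def)
    show "Min R \<in> S" "t < Min R" using Min_in[OF R] by (auto simp: R_def)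
    show "{Max L<..<Min R} \<inter> S = {}"
    proof (intro equals0I)
      fix s assume s: "s \<in> {Max L<..<Min R} \<inter> S"
      then have "s \<notin> L" "s \<notin> R"
        using Max_ge[OF L(1), of s] Min_le[OF R(1), of s] by auto
      then show False using s assms(6) by (auto simp: L_def R_def)
    qed
  qed
qed

lemma piecewise_smooth_pathE:
  assumes "piecewise_smooth_path g"
  obtains S where "continuous_on {0..1} g" "finite S" "{0, 1} \<subseteq> S" "S \<subseteq> {0..1}"
    "\<And>a b. a \<in> S \<Longrightarrow> b \<in> S \<Longrightarrow> a < b \<Longrightarrow> {a<..<b} \<inter> S = {} \<Longrightarrow>
      \<exists>g'. continuous_on {a..b} g' \<and>
        (\<forall>t\<in>{a..b}. (g has_vector_derivative g' t) (at t within {a..b}))"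
  using assms unfolding piecewise_smooth_path_def
  by (elim conjE exE) (rule that, assumption+, (drule (1) bspec)+, simp)

text \<open>Away from the partition, a piece contains a full neighbourhood of \<open>t\<close>, so
  its derivative within the piece is a two-sided one and coincides with the
  \<open>vector_derivative\<close> used in \<open>hyp_length\<close>.\<close>

lemma piecewise_smooth_path_differentiable:
  assumes "piecewise_smooth_path g"
  obtains S where "finite S" "{0, 1} \<subseteq> S"
    "\<And>t. t \<in> {0..1} - S \<Longrightarrow> (g has_vector_derivative vector_derivative g (at t within {0..1})) (at t)"
proof -
  obtain S where S: "finite S" "{0, 1} \<subseteq> S"
    and g: "\<And>a b. a \<in> S \<Longrightarrow> b \<in> S \<Longrightarrow> a < b \<Longrightarrow> {a<..<b} \<inter> S = {} \<Longrightarrow>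
          (\<exists>g'. continuous_on {a..b} g' \<and>
             (\<forall>t\<in>{a..b}. (g has_vector_derivative g' t) (at t within {a..b})))"
    using piecewise_smooth_pathE[OF assms] by metis
  have "(g has_vector_derivative vector_derivative g (at t within {0..1})) (at t)"
    if t: "t \<in> {0..1} - S" for t
  proof -
    have t01: "0 < t" "t < 1" using t S(2) by (auto simp: order.order_iff_strict)
    obtain c d where cd: "c \<in> S" "d \<in> S" "c < t" "t < d" "{c<..<d} \<inter> S = {}"
      using partition_neighbours[OF S(1), of 0 1 t] t S(2) by auto
    then obtain g' where "(g has_vector_derivative g' t) (at t within {c..d})"
      using g[of c d] by force
    then have *: "(g has_vector_derivative g' t) (at t)"
      using cd by (simp add: has_vector_derivative_def at_within_Icc_at)
    then have "vector_derivative g (at t within {0..1}) = g' t"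
      using t01 by (simp add: at_within_Icc_at vector_derivative_at)
    with * show ?thesis by simp
  qed
  with S that show thesis by blast
qed

lemma piecewise_smooth_path_integrable:
  assumes g: "piecewise_smooth_path g" "path_image g \<subseteq> D" and rho: "continuous_on D \<rho>"
  shows "(\<lambda>t. \<rho> (g t) * cmod (vector_derivative g (at t within {0..1}))) integrable_on {0..1}"
proof -
  obtain S where S: "finite S" "{0, 1} \<subseteq> S" "S \<subseteq> {0..1}"
    and g': "\<And>a b. a \<in> S \<Longrightarrow> b \<in> S \<Longrightarrow> a < b \<Longrightarrow> {a<..<b} \<inter> S = {} \<Longrightarrow>
          (\<exists>g'. continuous_on {a..b} g' \<and>
             (\<forall>t\<in>{a..b}. (g has_vector_derivative g' t) (at t within {a..b})))"
    and cont: "continuous_on {0..1} g"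
    using piecewise_smooth_pathE[OF g(1)] by metis
  show ?thesis
  proof (rule integrable_on_partition[OF S(1)])
    fix a b assume ab: "a \<in> S" "b \<in> S" "a < b" "{a<..<b} \<inter> S = {}"
    then obtain d where d: "continuous_on {a..b} d"
      "\<And>t. t \<in> {a..b} \<Longrightarrow> (g has_vector_derivative d t) (at t within {a..b})"
      using g' by blast
    have sub: "{a..b} \<subseteq> {0..1}" using ab S(3) by auto
    have "continuous_on {a..b} (\<lambda>t. \<rho> (g t))"
      by (rule continuous_on_compose2[OF rho continuous_on_subset[OF cont sub]])
        (use g(2) sub in \<open>auto simp: path_image_def\<close>)
    then have "(\<lambda>t. \<rho> (g t) * cmod (d t)) integrable_on {a..b}"
      by (intro integrable_continuous_interval continuous_intros d(1))
    then show "(\<lambda>t. \<rho> (g t) * cmod (vector_derivative g (at t within {0..1}))) integrable_on {a..b}"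
    \<comment> \<open>At the ends of a piece the derivative \<open>d\<close> is one-sided and may
      differ from \<open>vector_derivative g\<close>; two points do not affect
      integrability.\<close>
    proof (rule integrable_spike_finite[of "{a, b}", rotated 2])
      fix t assume t: "t \<in> {a..b} - {a, b}"
      then have "0 < t" "t < 1" using sub ab(3) by auto
      moreover have "(g has_vector_derivative d t) (at t)"
        using d(2)[of t] t by (simp add: has_vector_derivative_def at_within_Icc_at)
      ultimately show "\<rho> (g t) * cmod (vector_derivative g (at t within {0..1})) = \<rho> (g t) * cmod (d t)"
        by (simp add: at_within_Icc_at vector_derivative_at)
    qed simp
  qed (use S(2) in auto)
qed

section \<open>Length, distance and existence of connecting paths\<close>

lemma hyp_length_nonneg:
  assumes "hyperbolic_domain D" "path_image g \<subseteq> D"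
  shows "hyp_length D g \<ge> 0"
proof (cases "(\<lambda>t. hyp_density D (g t) * cmod (vector_derivative g (at t within {0..1}))) integrable_on {0..1}")
  case True
  then show ?thesis unfolding hyp_length_def
    using assms hyp_density_pos[OF assms(1)]
    by (intro integral_nonneg) (auto simp: path_image_def image_subset_iff less_imp_le)
qed (simp add: hyp_length_def not_integrable_integral)

text \<open>The real infimum lies below each length because the set of lengths is bounded below, by
  0.\<close>

lemma hyp_dist_le:
  assumes "hyperbolic_domain D" "piecewise_smooth_path g" "path_image g \<subseteq> D"
  shows "hyp_dist D (pathstart g) (pathfinish g) \<le> hyp_length D g"
  unfolding hyp_dist_def using assms hyp_length_nonneg
  by (intro cInf_lower bdd_belowI[where m=0]) auto

text \<open>Ensures that the infimum defining \<open>hyp_dist\<close> runs over a nonempty set. A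
  polynomial path serves, with \<open>{0, 1}\<close> as its partition.\<close>

lemma piecewise_smooth_path_exists:
  assumes "open D" "connected D" "x \<in> D" "y \<in> D"
  obtains g where "piecewise_smooth_path g" "path_image g \<subseteq> D" "pathstart g = x" "pathfinish g = y"
proof -
  obtain g where g: "polynomial_function g" "path_image g \<subseteq> D" "pathstart g = x" "pathfinish g = y"
    using connected_open_polynomial_connected[OF assms] by blast
  obtain g' where g': "polynomial_function g'" "\<And>t. (g has_vector_derivative g' t) (at t)"
    using has_vector_derivative_polynomial_function[OF g(1)] by blast
  have "piecewise_smooth_path g" unfolding piecewise_smooth_path_def
    using g(1) g' by (intro conjI exI[of _ "{0, 1}"] ballI impI exI[of _ g'])
      (auto intro: has_vector_derivative_at_within continuous_on_polymonial_function)
  with g that show thesis by blast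
qed

section \<open>Images of paths under a harmonic function\<close>

text \<open>The partition of \<open>g\<close> also works for the image: on each piece the chain rule
  gives the continuous derivative \<open>Re (f (g t) * d t)\<close>.\<close>

lemma piecewise_smooth_path_compose:
  assumes g: "piecewise_smooth_path g" "path_image g \<subseteq> D"
    and f: "continuous_on D f" "\<And>z. z \<in> D \<Longrightarrow> (v has_derivative (\<lambda>h. Re (f z * h))) (at z)"
  shows "piecewise_smooth_path (\<lambda>t. complex_of_real (v (g t)))"
proof -
  obtain S where S: "finite S" "{0, 1} \<subseteq> S" "S \<subseteq> {0..1}"
    and g': "\<And>a b. a \<in> S \<Longrightarrow> b \<in> S \<Longrightarrow> a < b \<Longrightarrow> {a<..<b} \<inter> S = {} \<Longrightarrow>
          (\<exists>g'. continuous_on {a..b} g' \<and>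
             (\<forall>t\<in>{a..b}. (g has_vector_derivative g' t) (at t within {a..b})))"
    and cont: "continuous_on {0..1} g"
    using piecewise_smooth_pathE[OF g(1)] by metis
  have gD: "g t \<in> D" if "t \<in> {0..1}" for t
    using g(2) that by (auto simp: path_image_def)
  have "continuous_on D v"
    by (meson f(2) continuous_at_imp_continuous_on has_derivative_continuous)
  then have "continuous_on {0..1} (\<lambda>t. complex_of_real (v (g t)))"
    by (intro continuous_on_of_real continuous_on_compose2[OF _ cont]) (use gD in auto)
  moreover have "\<exists>d. continuous_on {a..b} d \<and>
      (\<forall>t\<in>{a..b}. ((\<lambda>t. complex_of_real (v (g t))) has_vector_derivative d t) (at t within {a..b}))"
    if ab: "a \<in> S" "b \<in> S" "a < b" "{a<..<b} \<inter> S = {}" for a b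
  proof -
    obtain d where d: "continuous_on {a..b} d"
      "\<And>t. t \<in> {a..b} \<Longrightarrow> (g has_vector_derivative d t) (at t within {a..b})"
      using g'[OF ab] by blast
    have sub: "{a..b} \<subseteq> {0..1}" using ab S(3) by auto
    have "continuous_on {a..b} (\<lambda>t. f (g t))"
      by (rule continuous_on_compose2[OF f(1) continuous_on_subset[OF cont sub]]) (use gD sub in auto)
    then have "continuous_on {a..b} (\<lambda>t. complex_of_real (Re (f (g t) * d t)))"
      by (intro continuous_intros d(1))
    moreover have "((\<lambda>t. complex_of_real (v (g t))) has_vector_derivative complex_of_real (Re (f (g t) * d t)))
        (at t within {a..b})" if t: "t \<in> {a..b}" for t
    proof -
      have "g t \<in> D" using gD sub t by blast
      from has_derivative_compose[OF d(2)[OF t, unfolded has_vector_derivative_def] f(2)[OF this]]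
      have "((\<lambda>t. v (g t)) has_vector_derivative Re (f (g t) * d t)) (at t within {a..b})"
        by (simp add: has_vector_derivative_def right_diff_distrib)
      then show ?thesis by (rule bounded_linear.has_vector_derivative[OF bounded_linear_of_real])
    qed
    ultimately show ?thesis
      by (intro exI[of _ "\<lambda>t. complex_of_real (Re (f (g t) * d t))"] conjI ballI)
  qed
  ultimately show ?thesis unfolding piecewise_smooth_path_def
    by (intro conjI exI[of _ S] ballI impI S) (auto simp del: ex_simps)
qed

text \<open>Off a finite set the image path has speed at most \<open>cmod (f (g t))\<close> times
  the speed of \<open>g\<close>, so \<open>harmonic_gradient_bound\<close> compares the integrands
  pointwise.\<close>

lemma hyp_length_compose_le:
  assumes D: "hyperbolic_domain D" and v: "\<And>z. z \<in> D \<Longrightarrow> v z \<in> {-1<..<1}"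
    and f: "f holomorphic_on D" "\<And>z. z \<in> D \<Longrightarrow> (v has_derivative (\<lambda>h. Re (f z * h))) (at z)"
    and g: "piecewise_smooth_path g" "path_image g \<subseteq> D"
  shows "hyp_length (ball 0 1) (\<lambda>t. complex_of_real (v (g t))) \<le> 4 / pi * hyp_length D g"
proof -
  define k where "k t = complex_of_real (v (g t))" for t
  have gD: "g t \<in> D" if "t \<in> {0..1}" for t
    using g(2) that by (auto simp: path_image_def)
  have k1: "k t \<in> ball 0 1" if "t \<in> {0..1}" for t
    using v[OF gD[OF that]] by (auto simp: k_def abs_less_iff)
  have k: "piecewise_smooth_path k" "path_image k \<subseteq> ball 0 1"
    using piecewise_smooth_path_compose[OF g holomorphic_on_imp_continuous_on[OF f(1)] f(2)] k1
    unfolding k_def by (auto simp: path_image_def)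
  define R where "R t = 4 / pi * (hyp_density D (g t) * cmod (vector_derivative g (at t within {0..1})))" for t
  define L where "L t = hyp_density (ball 0 1) (k t) * cmod (vector_derivative k (at t within {0..1}))" for t
  obtain S where S: "finite S" "{0, 1} \<subseteq> S"
    "\<And>t. t \<in> {0..1} - S \<Longrightarrow> (g has_vector_derivative vector_derivative g (at t within {0..1})) (at t)"
    using piecewise_smooth_path_differentiable[OF g(1)] by blast
  have LR: "L t \<le> R t" if t: "t \<in> {0..1} - S" for t
  proof -
    have t01: "0 < t" "t < 1" "t \<in> {0..1}" using t S(2) by (auto simp: order.order_iff_strict)
    define d where "d = vector_derivative g (at t within {0..1})"
    have "(g has_vector_derivative d) (at t)" using S(3)[OF t] by (simp add: d_def)
    from has_derivative_compose[OF this[unfolded has_vector_derivative_def] f(2)[OF gD[OF t01(3)]]]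
    have "((\<lambda>t. v (g t)) has_vector_derivative Re (f (g t) * d)) (at t)"
      by (simp add: has_vector_derivative_def right_diff_distrib)
    then have "(k has_vector_derivative complex_of_real (Re (f (g t) * d))) (at t)"
      unfolding k_def by (rule bounded_linear.has_vector_derivative[OF bounded_linear_of_real])
    then have "vector_derivative k (at t within {0..1}) = complex_of_real (Re (f (g t) * d))"
      using t01 by (simp add: at_within_Icc_at vector_derivative_at)
    then have "cmod (vector_derivative k (at t within {0..1})) \<le> cmod (f (g t)) * cmod d"
      using abs_Re_le_cmod[of "f (g t) * d"]
      by (simp only: norm_of_real norm_mult)
    then have "L t \<le> hyp_density (ball 0 1) (k t) * (cmod (f (g t)) * cmod d)"
      unfolding L_def
      using hyp_density_pos[OF hyperbolic_domain_disk k1[OF t01(3)]]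
      by (intro mult_left_mono) auto
    also have "hyp_density (ball 0 1) (k t) = 2 / (1 - (v (g t))\<^sup>2)"
      using hyp_density_disk[OF k1[OF t01(3)]] by (simp add: k_def)
    also have "2 / (1 - (v (g t))\<^sup>2) * (cmod (f (g t)) * cmod d)
        = (2 / (1 - (v (g t))\<^sup>2) * cmod (f (g t))) * cmod d" by simp
    also have "\<dots> \<le> 4 / pi * hyp_density D (g t) * cmod d"
      by (intro mult_right_mono harmonic_gradient_bound[OF D v f] gD t01(3)) auto
    finally show ?thesis by (simp add: R_def d_def mult.assoc)
  qed
  have R: "R integrable_on {0..1}" unfolding R_def
    by (intro integrable_on_mult_right piecewise_smooth_path_integrable[OF g] continuous_on_hyp_density D)
  have L: "L integrable_on {0..1}" unfolding L_def
    by (intro piecewise_smooth_path_integrable[OF k] continuous_on_hyp_density hyperbolic_domain_disk)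
  \<comment> \<open>Nothing compares \<open>L\<close> with \<open>R\<close> at the partition points.
    Replacing \<open>L\<close> by \<open>R\<close> there makes the inequality hold on the whole
    interval without changing the integral.\<close>
  define L' where "L' t = (if t \<in> S then R t else L t)" for t
  have "integral {0..1} L = integral {0..1} L'"
    by (rule integral_spike[OF negligible_finite[OF S(1)]]) (simp add: L'_def)
  also have "\<dots> \<le> integral {0..1} R"
    by (rule integral_le[OF integrable_spike_finite[OF S(1) _ L] R]) (use LR in \<open>auto simp: L'_def\<close>)
  finally show ?thesis
    by (simp add: hyp_length_def L_def[abs_def] R_def[abs_def] k_def[abs_def])
qed

section \<open>From lengths to distances\<close>

theorem theorem1:
  fixes D :: "complex set" and v :: "complex \<Rightarrow> real"
  assumes "hyperbolic_domain D"
    and "real_harmonic_on v D"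
    and "\<forall>z\<in>D. v z \<in> {-1<..<1}"
  shows "\<forall>z1\<in>D. \<forall>z2\<in>D.
    hyp_dist (ball 0 1) (complex_of_real (v z1)) (complex_of_real (v z2)) \<le>
      4 / pi * hyp_dist D z1 z2"
proof (intro ballI)
  fix z1 z2 assume z: "z1 \<in> D" "z2 \<in> D"
  have D: "open D" "connected D" using assms(1) by (auto simp: hyperbolic_domain_def)
  obtain f where f: "f holomorphic_on D" "\<And>z. z \<in> D \<Longrightarrow> (v has_derivative (\<lambda>h. Re (f z * h))) (at z)"
    using harmonic_gradient[OF D(1) assms(2)] by blast
  let ?d = "hyp_dist (ball 0 1) (complex_of_real (v z1)) (complex_of_real (v z2))"
  let ?P = "\<lambda>g. piecewise_smooth_path g \<and> path_image g \<subseteq> D \<and> pathstart g = z1 \<and> pathfinish g = z2"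
  have v: "\<And>z. z \<in> D \<Longrightarrow> v z \<in> {-1<..<1}" using assms(3) by blast
  \<comment> \<open>With the constant moved to the left, this is a lower bound for the length of
    every competing path, as needed for the infimum.\<close>
  have "pi / 4 * ?d \<le> hyp_length D g" if g: "?P g" for g
  proof -
    define k where "k t = complex_of_real (v (g t))" for t
    have "k t \<in> ball 0 1" if "t \<in> {0..1}" for t
      using v[of "g t"] g that by (auto simp: k_def abs_less_iff path_image_def image_subset_iff)
    then have "path_image k \<subseteq> ball 0 1" by (auto simp: path_image_def)
    moreover have "piecewise_smooth_path k"
      using piecewise_smooth_path_compose[OF _ _ holomorphic_on_imp_continuous_on[OF f(1)] f(2)] g
      unfolding k_def by blast
    ultimately have "hyp_dist (ball 0 1) (pathstart k) (pathfinish k) \<le> hyp_length (ball 0 1) k"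
      by (intro hyp_dist_le hyperbolic_domain_disk)
    also have "\<dots> \<le> 4 / pi * hyp_length D g"
      using hyp_length_compose_le[OF assms(1) v f] g unfolding k_def by blast
    finally have "?d \<le> 4 / pi * hyp_length D g"
      using g by (auto simp: k_def pathstart_def pathfinish_def)
    then show ?thesis by (simp add: field_simps)
  qed
  \<comment> \<open>A lower bound of all lengths bounds their real infimum only if some path
    exists.\<close>
  moreover obtain g where "?P g" using piecewise_smooth_path_exists[OF D z] by blast
  ultimately have "pi / 4 * ?d \<le> hyp_dist D z1 z2"
    unfolding hyp_dist_def[of D] by (intro cInf_greatest) auto
  then show "?d \<le> 4 / pi * hyp_dist D z1 z2" by (simp add: field_simps)
qed

end
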